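(* Consider the source detection game on known static graphs that are trees, under obliviously dynamic source behavior. There is a Discoverer algorithm that watches at most two nodes per round, wins every instance of this game, and tolerates $O(n\log n)$ infections in expectation, where $n$ is the number of nodes.
   Context: A temporal graph $\mathcal{G}=(V,E,\lambda)$ with lifetime $T_{\max}$ consists of a finite simple undirected graph $(V,E)$, called the underlying static graph, together with a labeling $\lambda\colon E\to\{1,\dots,T_{\max}\}$. The edge $e$ is present only at time $\lambda(e)$. Write $n=|V|$. Infections follow the SIR model with duration $\delta\ge1$. A node may be seed-infected at some time. A susceptible node $u$ becomes infected at time $t$ iff some neighbor $v$ is infectious at time $t$ and $\lambda(uv)=t$; exactly one such neighbor counts as its infector. The node $u$ is then infectious at times $t+1,\dots,t+\delta$ and resistant afterwards. SD game: an Adversary fixes the temporal graph, $T_{\max}$, $\delta$, and a source node $s$, which is fixed for the whole game. The Discoverer is told $V$, $E$ (known static graph), $T_{\max}$ and $\delta$, but not $\lambda$. In each round the Discoverer watches a set of nodes (here at most two). All nodes start susceptible, the source is seed-infected at a time chosen by the Adversary for that round, and an infection chain unfolds. For each watched node, the Discoverer learns whether, when, and by which neighbor it was infected (or that it was the seed). Obliviously dynamic source behavior means the seed time (and hence the chain) may change between rounds, but the Adversary never learns which nodes are watched. The Discoverer eventually names a node and wins iff it is $s$. The number of tolerated infections is the total number of nodes infected, summed over all rounds, until the Discoverer stops. *)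

theory Defs
  imports "HOL-Probability.Probability" "HOL-Library.Landau_Symbols"
begin

definition simple_graph :: "'v set \<Rightarrow> 'v set set \<Rightarrow> bool" where
  "simple_graph V E \<longleftrightarrow> finite V \<and> (\<forall>e\<in>E. e \<subseteq> V \<and> card e = 2)"

definition walk :: "'v set \<Rightarrow> 'v set set \<Rightarrow> 'v list \<Rightarrow> bool" where
  "walk V E p \<longleftrightarrow> p \<noteq> [] \<and> set p \<subseteq> V \<and> successively (\<lambda>u v. {u, v} \<in> E) p"

definition connected_graph :: "'v set \<Rightarrow> 'v set set \<Rightarrow> bool" where
  "connected_graph V E \<longleftrightarrow>
     V \<noteq> {} \<and> (\<forall>u\<in>V. \<forall>v\<in>V. \<exists>p. walk V E p \<and> hd p = u \<and> last p = v)"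

definition cycle_of :: "'v set \<Rightarrow> 'v set set \<Rightarrow> 'v list \<Rightarrow> bool" where
  "cycle_of V E p \<longleftrightarrow> walk V E p \<and> distinct p \<and> length p \<ge> 3 \<and> {last p, hd p} \<in> E"

text \<open>The constant \<open>tree\<close> of the AFP entry Graph_Theory is not used: it concerns
  digraphs, where an undirected edge (two opposite arcs) already forms a cycle.\<close>

definition tree_graph :: "'v set \<Rightarrow> 'v set set \<Rightarrow> bool" where
  "tree_graph V E \<longleftrightarrow> simple_graph V E \<and> connected_graph V E \<and> (\<nexists>p. cycle_of V E p)"

definition temporal_graph :: "'v set \<Rightarrow> 'v set set \<Rightarrow> ('v set \<Rightarrow> nat) \<Rightarrow> nat \<Rightarrow> bool" where
  "temporal_graph V E l Tmax \<longleftrightarrow> simple_graph V E \<and> (\<forall>e\<in>E. l e \<in> {1..Tmax})"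

text \<open>An infection chain maps every node that gets infected to its infection time and
  the cause of the infection; nodes that are never infected are mapped to \<open>None\<close>.\<close>

datatype 'v cause = Seed | Infector 'v

type_synonym 'v chain = "'v \<rightharpoonup> nat \<times> 'v cause"

definition infected_at :: "'v chain \<Rightarrow> 'v \<Rightarrow> nat \<Rightarrow> bool" where
  "infected_at X u t \<longleftrightarrow> (\<exists>c. X u = Some (t, c))"

definition susceptible_at :: "'v chain \<Rightarrow> 'v \<Rightarrow> nat \<Rightarrow> bool" where
  "susceptible_at X u t \<longleftrightarrow> (\<forall>t'<t. \<not> infected_at X u t')"

definition infectious_at :: "nat \<Rightarrow> 'v chain \<Rightarrow> 'v \<Rightarrow> nat \<Rightarrow> bool" where
  "infectious_at \<delta> X v t \<longleftrightarrow> (\<exists>t'. infected_at X v t' \<and> t \<in> {t' + 1..t' + \<delta>})"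

definition transmits ::
  "'v set set \<Rightarrow> ('v set \<Rightarrow> nat) \<Rightarrow> nat \<Rightarrow> 'v chain \<Rightarrow> 'v \<Rightarrow> 'v \<Rightarrow> nat \<Rightarrow> bool" where
  "transmits E l \<delta> X v u t \<longleftrightarrow> {u, v} \<in> E \<and> l {u, v} = t \<and> infectious_at \<delta> X v t"

text \<open>Seed time 0 is allowed; otherwise edges with label 1 could never transmit.\<close>

definition infection_chain ::
  "'v set \<Rightarrow> 'v set set \<Rightarrow> ('v set \<Rightarrow> nat) \<Rightarrow> nat \<Rightarrow> 'v \<Rightarrow> nat \<Rightarrow> 'v chain \<Rightarrow> bool" where
  "infection_chain V E l \<delta> s t\<^sub>0 X \<longleftrightarrow>
     dom X \<subseteq> V \<and>
     X s = Some (t\<^sub>0, Seed) \<and>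
     (\<forall>u\<in>V - {s}. \<forall>t. infected_at X u t \<longleftrightarrow>
        susceptible_at X u t \<and> (\<exists>v. transmits E l \<delta> X v u t)) \<and>
     (\<forall>u\<in>V - {s}. \<forall>t c. X u = Some (t, c) \<longrightarrow>
        (\<exists>v. c = Infector v \<and> transmits E l \<delta> X v u t))"

text \<open>Since the Adversary learns nothing during the game, its behaviour over all rounds is a
  sequence of chains, one per round, that is fixed in advance.\<close>

definition sd_instance ::
  "'v set \<Rightarrow> 'v set set \<Rightarrow> nat \<Rightarrow> nat \<Rightarrow> ('v set \<Rightarrow> nat) \<Rightarrow> 'v \<Rightarrow> (nat \<Rightarrow> 'v chain) \<Rightarrow> bool" where
  "sd_instance V E Tmax \<delta> l s X \<longleftrightarrow>
     temporal_graph V E l Tmax \<and> \<delta> \<ge> 1 \<and> s \<in> V \<and>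
     (\<forall>i. \<exists>t\<^sub>0. infection_chain V E l \<delta> s t\<^sub>0 (X i))"

datatype 'v action = Watch "'v set" | Name 'v

text \<open>A history lists, for every past round, the watched set and the chain restricted to it.\<close>

type_synonym 'v history = "('v set \<times> 'v chain) list"
type_synonym 'v strategy = "'v history \<Rightarrow> 'v action"

primrec history :: "'v strategy \<Rightarrow> (nat \<Rightarrow> 'v chain) \<Rightarrow> nat \<Rightarrow> 'v history" where
  "history \<sigma> X 0 = []"
| "history \<sigma> X (Suc i) =
     (case \<sigma> (history \<sigma> X i) of
        Watch W \<Rightarrow> history \<sigma> X i @ [(W, X i |` W)]
      | Name v \<Rightarrow> history \<sigma> X i)"

definition watches_at_most :: "nat \<Rightarrow> 'v set \<Rightarrow> 'v strategy \<Rightarrow> bool" where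
  "watches_at_most k V \<sigma> \<longleftrightarrow> (\<forall>h W. \<sigma> h = Watch W \<longrightarrow> W \<subseteq> V \<and> card W \<le> k)"

text \<open>The history is constant once a node has been named, so at most one node is ever named.\<close>

definition wins :: "'v strategy \<Rightarrow> (nat \<Rightarrow> 'v chain) \<Rightarrow> 'v \<Rightarrow> bool" where
  "wins \<sigma> X s \<longleftrightarrow> (\<exists>k. \<sigma> (history \<sigma> X k) = Name s)"

definition tolerated_infections :: "'v strategy \<Rightarrow> (nat \<Rightarrow> 'v chain) \<Rightarrow> ennreal" where
  "tolerated_infections \<sigma> X =
     (\<Sum>i. case \<sigma> (history \<sigma> X i) of
             Watch W \<Rightarrow> of_nat (card (dom (X i)))
           | Name v \<Rightarrow> 0)"

text \<open>A randomized Discoverer draws a deterministic strategy from a distribution that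
  depends only on what it is told: \<open>V\<close>, \<open>E\<close>, \<open>Tmax\<close> and \<open>\<delta>\<close>.\<close>

type_synonym 'v discoverer =
  "'v set \<Rightarrow> 'v set set \<Rightarrow> nat \<Rightarrow> nat \<Rightarrow> 'v strategy pmf"

definition expected_infections :: "'v strategy pmf \<Rightarrow> (nat \<Rightarrow> 'v chain) \<Rightarrow> ennreal" where
  "expected_infections p X = (\<integral>\<^sup>+\<sigma>. tolerated_infections \<sigma> X \<partial>measure_pmf p)"

end

theory Submission
  imports Defs "HOL-Library.Discrete_Functions" "HOL-Library.Transitive_Closure_Table"
begin

text \<open>The Discoverer keeps a set \<open>C\<close> of candidates for the source. In every round it watches the
  centroid \<open>m\<close> of \<open>C\<close>, that is, a node all of whose sides contain at most half of \<open>C\<close>, together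
  with a uniformly random node \<open>u\<close>. If \<open>u\<close> is infected, then \<open>C\<close> is halved: either \<open>m\<close> is infected
  too, and the source lies on the side of its infector, or \<open>m\<close> is not infected, and the source
  lies on the side of \<open>u\<close>, since the infection reached \<open>u\<close> without passing through \<open>m\<close>. A round
  with \<open>k\<close> infections succeeds in this way with probability \<open>k / n\<close>, so that each halving costs
  \<open>n\<close> infections in expectation.

  A pmf has countable support and every strategy in its support has to win, so only finitely many
  rounds are random. They are followed by \<open>log n\<close> sweeps in which \<open>u\<close> runs through all nodes; as the
  source itself is always infected, every sweep halves \<open>C\<close>. The random rounds are so numerous
  that the sweeps contribute only \<open>O(n log n)\<close> to the expectation.\<close>

definition avoiding :: "'v set \<Rightarrow> 'v set set \<Rightarrow> 'v \<Rightarrow> 'v \<Rightarrow> 'v \<Rightarrow> bool" where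
  "avoiding V E m a b \<longleftrightarrow> a \<in> V - {m} \<and> b \<in> V - {m} \<and> {a, b} \<in> E"

definition side :: "'v set \<Rightarrow> 'v set set \<Rightarrow> 'v \<Rightarrow> 'v \<Rightarrow> 'v set" where
  "side V E m w = {v. (avoiding V E m)\<^sup>*\<^sup>* w v}"

lemma avoiding_rtranclp_sym:
  "(avoiding V E m)\<^sup>*\<^sup>* a b \<Longrightarrow> (avoiding V E m)\<^sup>*\<^sup>* b a"
proof (induction rule: rtranclp_induct)
  case (step y z)
  then have "avoiding V E m z y"
    by (auto simp: avoiding_def insert_commute)
  with step.IH show ?case
    by (rule converse_rtranclp_into_rtranclp[rotated])
qed simp

lemma side_subset: "w \<in> V - {m} \<Longrightarrow> side V E m w \<subseteq> V - {m}"
  by (auto simp: side_def avoiding_def elim: rtranclp.cases)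

lemma side_eq: "v \<in> side V E m w \<Longrightarrow> side V E m v = side V E m w"
  unfolding side_def
  by (auto intro: rtranclp_trans avoiding_rtranclp_sym)

lemma walk_imp_rtranclp:
  "walk V E p \<Longrightarrow> (\<lambda>a b. a \<in> V \<and> b \<in> V \<and> {a, b} \<in> E)\<^sup>*\<^sup>* (hd p) (last p)"
proof (induction p rule: induct_list012)
  case (3 x y zs)
  then have "(\<lambda>a b. a \<in> V \<and> b \<in> V \<and> {a, b} \<in> E)\<^sup>*\<^sup>* y (last (y # zs))"
    and "x \<in> V \<and> y \<in> V \<and> {x, y} \<in> E"
    by (auto simp: walk_def)
  then show ?case
    by (auto intro: converse_rtranclp_into_rtranclp)
qed (auto simp: walk_def)

lemma side_meets_neighbour:
  assumes "connected_graph V E" "m \<in> V" "x \<in> V - {m}"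
  obtains y where "y \<in> side V E m x" "y \<in> V - {m}" "{y, m} \<in> E"
proof -
  let ?A = "\<lambda>a b. a \<in> V \<and> b \<in> V \<and> {a, b} \<in> E"
  obtain p where "walk V E p" "hd p = x" "last p = m"
    using assms unfolding connected_graph_def by blast
  then have "?A\<^sup>*\<^sup>* x m" using walk_imp_rtranclp by fastforce
  then have "x \<noteq> m \<longrightarrow> (\<exists>y. y \<in> side V E m x \<and> y \<in> V - {m} \<and> {y, m} \<in> E)"
  proof (induction rule: converse_rtranclp_induct)
    case (step x z)
    show ?case
    proof (cases "z = m")
      case True
      with step show ?thesis by (auto simp: side_def)
    next
      case False
      show ?thesis
      proof
        assume "x \<noteq> m"
        with False step have "avoiding V E m x z" by (auto simp: avoiding_def)
        with step False show "\<exists>y. y \<in> side V E m x \<and> y \<in> V - {m} \<and> {y, m} \<in> E"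
          by (auto simp: side_def intro: converse_rtranclp_into_rtranclp)
      qed
    qed
  qed simp
  with assms that show thesis by blast
qed

lemma rtrancl_path_imp_successively:
  "rtrancl_path r x xs y \<Longrightarrow> successively r (x # xs) \<and> last (x # xs) = y"
  by (induction rule: rtrancl_path.induct) auto

lemma tree_edge_sides_disjoint:
  assumes tree: "tree_graph V E" and edge: "{a, b} \<in> E" "a \<in> V" "b \<in> V" "a \<noteq> b"
  shows "side V E a b \<inter> side V E b a = {}"
proof (rule ccontr)
  assume "\<not> ?thesis"
  then obtain z where z: "(avoiding V E a)\<^sup>*\<^sup>* b z" "(avoiding V E b)\<^sup>*\<^sup>* a z"
    by (auto simp: side_def)
  let ?Q = "\<lambda>x y. x \<in> V \<and> y \<in> V \<and> {x, y} \<in> E \<and> {x, y} \<noteq> {a, b}"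
  have "?Q\<^sup>*\<^sup>* b z"
    using z(1) by (rule rtranclp_mono[THEN predicate2D, rotated])
      (auto simp: avoiding_def doubleton_eq_iff)
  moreover have "?Q\<^sup>*\<^sup>* z a"
    using avoiding_rtranclp_sym[OF z(2)] by (rule rtranclp_mono[THEN predicate2D, rotated])
      (auto simp: avoiding_def doubleton_eq_iff)
  ultimately have "?Q\<^sup>*\<^sup>* b a" by (rule rtranclp_trans)
  then obtain xs where "rtrancl_path ?Q b xs a"
    by (auto simp: rtranclp_eq_rtrancl_path)
  then obtain xs where xs: "rtrancl_path ?Q b xs a" "distinct (b # xs)"
    by (rule rtrancl_path_distinct)
  from rtrancl_path_imp_successively[OF xs(1)]
  have succ: "successively ?Q (b # xs)" and last: "last (b # xs) = a" by auto
  obtain x y ys where xs_eq: "xs = x # y # ys"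
  proof (cases xs)
    case Nil
    with last edge show thesis by simp
  next
    case (Cons x xs')
    with succ last edge that show thesis by (cases xs') (auto simp: insert_commute)
  qed
  have "set (b # xs) \<subseteq> V"
    using edge xs(1) by (auto dest!: rtrancl_path_Range)
  moreover have "successively (\<lambda>u v. {u, v} \<in> E) (b # xs)"
    using succ by (rule successively_mono) auto
  ultimately have "cycle_of V E (b # xs)"
    using xs(2) last edge xs_eq by (simp add: cycle_of_def walk_def)
  with tree show False by (auto simp: tree_graph_def)
qed

lemma ex_weighted_centroid:
  assumes tree: "tree_graph V E" and C: "C \<subseteq> V"
  shows "\<exists>m\<in>V. \<forall>w\<in>V - {m}. 2 * card (C \<inter> side V E m w) \<le> card C"
proof (rule ccontr)
  assume no: "\<not> ?thesis"
  have fin: "finite V" and conn: "connected_graph V E" and "V \<noteq> {}"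
    using tree by (auto simp: tree_graph_def simple_graph_def connected_graph_def)
  have finC: "finite C" using C fin by (rule finite_subset)
  define heavy where
    "heavy = (\<lambda>(m, w). m \<in> V \<and> w \<in> V - {m} \<and> 2 * card (C \<inter> side V E m w) > card C)"
  have heavy_ex: "\<exists>w. heavy (m, w)" if "m \<in> V" for m
    using no that by (fastforce simp: heavy_def)
  obtain p where p: "heavy p"
    and min: "\<And>q. heavy q \<Longrightarrow> card (side V E (fst p) (snd p)) \<le> card (side V E (fst q) (snd q))"
    using heavy_ex \<open>V \<noteq> {}\<close>
      ex_has_least_nat[of heavy _ "\<lambda>q. card (side V E (fst q) (snd q))"] by blast
  obtain m w where mw: "p = (m, w)" by fastforce
  have m: "m \<in> V" "w \<in> V - {m}" "2 * card (C \<inter> side V E m w) > card C"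
    using p by (auto simp: heavy_def mw)
  obtain w' where w': "w' \<in> side V E m w" "w' \<in> V - {m}" "{w', m} \<in> E"
    using side_meets_neighbour[OF conn m(1,2)] by blast
  have side_w': "side V E m w' = side V E m w" using w'(1) by (rule side_eq)
  obtain x where x: "heavy (w', x)" using heavy_ex w'(2) by blast
  then have xV: "x \<in> V - {w'}" and xC: "2 * card (C \<inter> side V E w' x) > card C"
    by (auto simp: heavy_def)
  show False
  proof (cases "m \<in> side V E w' x")
    case True
    then have "side V E w' x = side V E w' m" by (rule side_eq[symmetric])
    moreover have "side V E w' m \<inter> side V E m w' = {}"
      using tree_edge_sides_disjoint[OF tree w'(3)] w'(2) m(1) by auto
    ultimately have "card (C \<inter> side V E w' x) + card (C \<inter> side V E m w)
        = card (C \<inter> side V E w' x \<union> C \<inter> side V E m w)"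
      using finC side_w' by (subst card_Un_disjoint) auto
    also have "\<dots> \<le> card C" using finC by (intro card_mono) auto
    finally show False using xC m(3) by linarith
  next
    case False
    obtain y where y: "y \<in> side V E w' x" "y \<in> V - {w'}" "{y, w'} \<in> E"
      using side_meets_neighbour[OF conn _ xV] w'(2) by blast
    have "side V E w' x \<subseteq> side V E m w'"
    proof
      fix v assume "v \<in> side V E w' x"
      then have "(avoiding V E w')\<^sup>*\<^sup>* y v"
        using side_eq[OF y(1)] by (auto simp: side_def)
      then show "v \<in> side V E m w'"
      proof (induction rule: rtranclp_induct)
        case base
        from y w'(2) False have "avoiding V E m w' y"
          by (auto simp: avoiding_def insert_commute)
        then show ?case by (auto simp: side_def)
      next
        case (step u v)
        have "u \<in> side V E w' x" "v \<in> side V E w' x"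
          using y(1) step.hyps unfolding side_def by (auto intro: rtranclp_trans rtranclp.intros)
        with False step.hyps(2) have "avoiding V E m u v"
          by (auto simp: avoiding_def)
        with step.IH show ?case by (auto simp: side_def intro: rtranclp.intros)
      qed
    qed
    moreover have "w' \<notin> side V E w' x" using side_subset[OF xV] by blast
    moreover have "finite (side V E m w)"
      using fin side_subset[OF m(2)] by (meson finite_Diff finite_subset)
    ultimately have "card (side V E w' x) < card (side V E m w)"
      using w'(1) side_w' by (intro psubset_card_mono) auto
    with min[OF x] show False by (simp add: mw)
  qed
qed

lemma infected_connected_to_source:
  assumes chain: "infection_chain V E l \<delta> s t\<^sub>0 X"
    and "X u = Some (t, c)" "\<And>t' c'. X m = Some (t', c') \<Longrightarrow> t < t'"
  shows "s \<in> side V E m u"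
  using assms(2,3)
proof (induction t arbitrary: u c rule: less_induct)
  case (less t)
  have dom: "dom X \<subseteq> V" using chain by (simp add: infection_chain_def)
  show ?case
  proof (cases "u = s")
    case True
    then show ?thesis by (simp add: side_def)
  next
    case False
    have u: "u \<in> V" "u \<noteq> m" using dom less.prems by force+
    with False chain less.prems(1) obtain v where v: "transmits E l \<delta> X v u t"
      unfolding infection_chain_def by blast
    then obtain t' c' where v': "{u, v} \<in> E" "X v = Some (t', c')" "t' < t"
      by (auto simp: transmits_def infectious_at_def infected_at_def)
    have "v \<in> V" "v \<noteq> m" using dom v' less.prems(2) by force+
    then have "avoiding V E m u v" using u v' by (auto simp: avoiding_def)
    moreover have "s \<in> side V E m v"
      using less.IH[OF v'(3,2)] less.prems(2) v'(3) by force
    ultimately show ?thesis by (auto simp: side_def intro: converse_rtranclp_into_rtranclp)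
  qed
qed

lemma side_of_infected_contains_source:
  assumes "infection_chain V E l \<delta> s t\<^sub>0 X" "X u = Some y" "X m = None"
  shows "s \<in> side V E m u"
  using infected_connected_to_source[OF assms(1), of u "fst y" "snd y" m] assms(2,3) by simp

lemma side_of_infector_contains_source:
  assumes chain: "infection_chain V E l \<delta> s t\<^sub>0 X" and m: "X m = Some (t, Infector w)"
  shows "s \<in> side V E m w" "w \<in> V - {m}"
proof -
  have dom: "dom X \<subseteq> V" using chain by (simp add: infection_chain_def)
  have "m \<in> V" "m \<noteq> s" using chain m dom by (auto simp: infection_chain_def)
  with chain m have "transmits E l \<delta> X w m t"
    unfolding infection_chain_def by fastforce
  then obtain t' c' where w: "X w = Some (t', c')" "t' < t"
    by (auto simp: transmits_def infectious_at_def infected_at_def)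
  then show "w \<in> V - {m}" using dom m by auto
  show "s \<in> side V E m w"
    using infected_connected_to_source[OF chain w(1), of m] w(2) m by simp
qed

lemma seed_is_source:
  assumes chain: "infection_chain V E l \<delta> s t\<^sub>0 X" and m: "X m = Some (t, Seed)"
  shows "m = s"
  using assms unfolding infection_chain_def by blast

definition centroid :: "'v set \<Rightarrow> 'v set set \<Rightarrow> 'v set \<Rightarrow> 'v" where
  "centroid V E C = (SOME m. m \<in> V \<and> (\<forall>w\<in>V - {m}. 2 * card (C \<inter> side V E m w) \<le> card C))"

lemma centroid:
  assumes "tree_graph V E" "C \<subseteq> V"
  shows "centroid V E C \<in> V"
    and "w \<in> V - {centroid V E C} \<Longrightarrow> 2 * card (C \<inter> side V E (centroid V E C) w) \<le> card C"
proof -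
  have "\<exists>m. m \<in> V \<and> (\<forall>w\<in>V - {m}. 2 * card (C \<inter> side V E m w) \<le> card C)"
    using ex_weighted_centroid[OF assms] by blast
  from someI_ex[OF this]
  show "centroid V E C \<in> V"
    "w \<in> V - {centroid V E C} \<Longrightarrow> 2 * card (C \<inter> side V E (centroid V E C) w) \<le> card C"
    unfolding centroid_def by blast+
qed

text \<open>If the centroid \<open>m\<close> is not infected but the other watched node \<open>u\<close> is, then
  \<open>dom Y = {u}\<close>, and the infection reached \<open>u\<close> from the source without passing through \<open>m\<close>.\<close>

definition narrow :: "'v set \<Rightarrow> 'v set set \<Rightarrow> 'v set \<Rightarrow> 'v chain \<Rightarrow> 'v set" where
  "narrow V E C Y =
     (let m = centroid V E C in
      case Y m of
        Some (t, Seed) \<Rightarrow> C \<inter> {m}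
      | Some (t, Infector w) \<Rightarrow> C \<inter> side V E m w
      | None \<Rightarrow> if dom Y = {} then C else C \<inter> side V E m (the_elem (dom Y)))"

abbreviation (input) probe :: "'v set \<Rightarrow> 'v set set \<Rightarrow> 'v set \<Rightarrow> 'v \<Rightarrow> 'v set" where
  "probe V E C u \<equiv> V \<inter> {u, centroid V E C}"

lemma narrow_subset: "narrow V E C Y \<subseteq> C"
  by (auto simp: narrow_def Let_def split: option.splits cause.splits if_splits)

lemma
  assumes tree: "tree_graph V E" and chain: "infection_chain V E l \<delta> s t\<^sub>0 X"
    and C: "C \<subseteq> V" "s \<in> C"
  shows source_in_narrow: "s \<in> narrow V E C (X |` probe V E C u)"
    and card_narrow_infected: "u \<in> dom X \<Longrightarrow> 2 \<le> card C \<Longrightarrow>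
      2 * card (narrow V E C (X |` probe V E C u)) \<le> card C"
proof -
  let ?m = "centroid V E C"
  have m: "?m \<in> V" using centroid(1)[OF tree C(1)] .
  have dom: "dom X \<subseteq> V" using chain by (simp add: infection_chain_def)
  have "s \<in> narrow V E C (X |` probe V E C u) \<and>
    (u \<in> dom X \<longrightarrow> 2 \<le> card C \<longrightarrow> 2 * card (narrow V E C (X |` probe V E C u)) \<le> card C)"
  proof (cases "X ?m")
    case None
    show ?thesis
    proof (cases "u \<in> dom X")
      case True
      then obtain y where y: "X u = Some y" by blast
      have u: "u \<in> V - {?m}" using True None dom by auto
      have "dom (X |` probe V E C u) = {u}" using True None u by auto
      then have "narrow V E C (X |` probe V E C u) = C \<inter> side V E ?m u"
        using None m by (simp add: narrow_def Let_def)
      then show ?thesis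
        using centroid(2)[OF tree C(1) u] side_of_infected_contains_source[OF chain y None] C
        by simp
    next
      case False
      then have "dom (X |` probe V E C u) = {}" using None by auto
      then have "narrow V E C (X |` probe V E C u) = C"
        using None m by (simp add: narrow_def Let_def)
      then show ?thesis using False C by simp
    qed
  next
    case (Some y)
    show ?thesis
    proof (cases "snd y")
      case Seed
      then have X: "X ?m = Some (fst y, Seed)" using Some by (cases y) auto
      then have "narrow V E C (X |` probe V E C u) = {?m}"
        using m seed_is_source[OF chain X] C by (simp add: narrow_def Let_def)
      then show ?thesis using seed_is_source[OF chain X] by simp
    next
      case (Infector w)
      then have X: "X ?m = Some (fst y, Infector w)" using Some by (cases y) auto
      then have "narrow V E C (X |` probe V E C u) = C \<inter> side V E ?m w"
        using m by (simp add: narrow_def Let_def)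
      then show ?thesis
        using side_of_infector_contains_source[OF chain X] centroid(2)[OF tree C(1)] C by simp
    qed
  qed
  then show "s \<in> narrow V E C (X |` probe V E C u)"
    "u \<in> dom X \<Longrightarrow> 2 \<le> card C \<Longrightarrow> 2 * card (narrow V E C (X |` probe V E C u)) \<le> card C"
    by blast+
qed

definition candidates :: "'v set \<Rightarrow> 'v set set \<Rightarrow> 'v history \<Rightarrow> 'v set" where
  "candidates V E h = foldl (\<lambda>C (W, Y). narrow V E C Y) V h"

definition probing :: "'v set \<Rightarrow> 'v set set \<Rightarrow> 'v list \<Rightarrow> 'v strategy" where
  "probing V E us h =
     (let C = candidates V E h in
      if length h < length us \<and> 2 \<le> card C then Watch (probe V E C (us ! length h))
      else Name (SOME v. v \<in> C))"

lemma probing_exhausted: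
  "length us \<le> length h \<Longrightarrow> probing V E us h = Name (SOME v. v \<in> candidates V E h)"
  by (simp add: probing_def Let_def)

lemma watches_at_most_probing: "watches_at_most 2 V (probing V E us)"
proof -
  have "card (V \<inter> {a, b}) \<le> 2" for a b :: 'a
    by (rule order.trans[OF card_mono[of "{a, b}"]]) (auto simp: card_insert_if)
  then show ?thesis
    by (auto simp: watches_at_most_def probing_def Let_def split: if_splits)
qed

fun probing_cost :: "'v set \<Rightarrow> 'v set set \<Rightarrow> (nat \<Rightarrow> 'v chain) \<Rightarrow> nat \<Rightarrow> 'v set \<Rightarrow> 'v list \<Rightarrow> nat" where
  "probing_cost V E X i C [] = 0"
| "probing_cost V E X i C (u # us) =
     (if 2 \<le> card C
      then card (dom (X i)) + probing_cost V E X (Suc i) (narrow V E C (X i |` probe V E C u)) us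
      else 0)"

lemma suminf_ennreal_split_head:
  fixes f :: "nat \<Rightarrow> ennreal"
  shows "(\<Sum>j. f (j + i)) = (\<Sum>j. f (j + Suc i)) + f i"
  using suminf_offset[of "\<lambda>j. f (j + i)" 1] by simp

lemma history_constant:
  assumes "\<sigma> (history \<sigma> Z i) = Name v"
  shows "history \<sigma> Z (i + j) = history \<sigma> Z i"
  by (induction j) (use assms in auto)

lemma sum_lists_Suc:
  fixes g :: "'a list \<Rightarrow> nat"
  assumes "finite A"
  shows "sum g {us. set us \<subseteq> A \<and> length us = Suc j}
    = (\<Sum>u\<in>A. \<Sum>us\<in>{us. set us \<subseteq> A \<and> length us = j}. g (u # us))"
proof -
  have "sum g {us. set us \<subseteq> A \<and> length us = Suc j}
    = (\<Sum>(us, u)\<in>{us. set us \<subseteq> A \<and> length us = j} \<times> A. g (u # us))"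
    unfolding lists_length_Suc_eq
    by (subst sum.reindex) (auto simp: inj_on_def case_prod_unfold)
  also have "\<dots> = (\<Sum>us\<in>{us. set us \<subseteq> A \<and> length us = j}. \<Sum>u\<in>A. g (u # us))"
    by (rule sum.cartesian_product[symmetric])
  also have "\<dots> = (\<Sum>u\<in>A. \<Sum>us\<in>{us. set us \<subseteq> A \<and> length us = j}. g (u # us))"
    by (rule sum.swap)
  finally show ?thesis .
qed

context
  fixes V :: "'v set" and E l \<delta> s and X :: "nat \<Rightarrow> 'v chain"
  assumes tree: "tree_graph V E"
    and chain: "\<And>i. \<exists>t\<^sub>0. infection_chain V E l \<delta> s t\<^sub>0 (X i)"
begin

lemma finite_V: "finite V"
  using tree by (simp add: tree_graph_def simple_graph_def)

lemma dom_chain_subset: "dom (X i) \<subseteq> V"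
  using chain[of i] by (auto simp: infection_chain_def)

lemma source_infected: "s \<in> dom (X i)"
  using chain[of i] by (auto simp: infection_chain_def)

lemma source_in_V: "s \<in> V"
  using source_infected dom_chain_subset by blast

lemma source_in_narrow':
  "C \<subseteq> V \<Longrightarrow> s \<in> C \<Longrightarrow> s \<in> narrow V E C (X i |` probe V E C u)"
  using chain[of i] source_in_narrow[OF tree] by blast

lemma floor_log_narrow_le:
  assumes "C \<subseteq> V"
  shows "floor_log (card (narrow V E C Y)) \<le> floor_log (card C)"
  using finite_subset[OF assms finite_V] narrow_subset by (intro floor_log_le_iff card_mono)

lemma floor_log_narrow_infected:
  assumes "C \<subseteq> V" "s \<in> C" "u \<in> dom (X i)" "2 \<le> card C"
  shows "Suc (floor_log (card (narrow V E C (X i |` probe V E C u)))) \<le> floor_log (card C)"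
proof -
  have "2 * card (narrow V E C (X i |` probe V E C u)) \<le> card C"
    using chain[of i] card_narrow_infected[OF tree] assms by blast
  then have "floor_log (card (narrow V E C (X i |` probe V E C u))) \<le> floor_log (card C div 2)"
    by (intro floor_log_le_iff) linarith
  also have "Suc \<dots> = floor_log (card C)" using floor_log_rec[OF assms(4)] by (rule sym)
  finally show ?thesis by simp
qed

lemma name_source:
  assumes "candidates V E h = C" "C \<subseteq> V" "s \<in> C" "\<not> 2 \<le> card C"
  shows "probing V E us h = Name s"
proof -
  have "card C = 1"
    using assms(2-4) finite_subset[OF assms(2) finite_V] by (cases "card C") auto
  then have "C = {s}" using assms(3) by (auto simp: card_1_singleton_iff)
  with assms(1,4) show ?thesis by (simp add: probing_def)
qed

lemma history_probing_Suc:
  fixes us i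
  defines "h \<equiv> history (probing V E us) X i"
  assumes h: "length h = i" "candidates V E h = C" and us: "drop i us = u # us'"
    and C: "2 \<le> card C"
  shows "probing V E us h = Watch (probe V E C u)"
    and "length (history (probing V E us) X (Suc i)) = Suc i"
    and "candidates V E (history (probing V E us) X (Suc i)) = narrow V E C (X i |` probe V E C u)"
    and "drop (Suc i) us = us'"
proof -
  have i: "i < length us" using us by (metis drop_eq_Nil leI list.distinct(1))
  then have "us ! i = u" and us': "drop (Suc i) us = us'"
    using us by (simp_all add: Cons_nth_drop_Suc[symmetric])
  then show w: "probing V E us h = Watch (probe V E C u)"
    using h C i by (simp add: probing_def)
  show "drop (Suc i) us = us'" by (fact us')
  have hist: "history (probing V E us) X (Suc i) = h @ [(probe V E C u, X i |` probe V E C u)]"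
    using w by (simp add: h_def)
  show "length (history (probing V E us) X (Suc i)) = Suc i"
    unfolding hist using h by simp
  show "candidates V E (history (probing V E us) X (Suc i)) = narrow V E C (X i |` probe V E C u)"
    unfolding hist using h(2) by (simp add: candidates_def)
qed

lemma probing_wins_aux:
  assumes "length (history (probing V E us) X i) = i"
    and "candidates V E (history (probing V E us) X i) = C"
    and "drop i us = us'" "C \<subseteq> V" "s \<in> C"
    and "floor_log (card C) \<le> count_list us' s"
  shows "wins (probing V E us) X s"
  using assms
proof (induction us' arbitrary: i C)
  case Nil
  then have "\<not> 2 \<le> card C" using floor_log_rec[of "card C"] by (auto simp del: floor_log_half)
  with Nil.prems show ?case unfolding wins_def by (blast intro: name_source)
next
  case (Cons u us')
  show ?case
  proof (cases "2 \<le> card C")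
    case False
    with Cons.prems show ?thesis unfolding wins_def by (blast intro: name_source)
  next
    case True
    let ?C = "narrow V E C (X i |` probe V E C u)"
    note hist = history_probing_Suc[OF Cons.prems(1-3) True]
    have "floor_log (card ?C) \<le> count_list us' s"
      using floor_log_narrow_le[OF Cons.prems(4), of "X i |` probe V E C u"]
        floor_log_narrow_infected[OF Cons.prems(4,5) source_infected True, of i] Cons.prems(6)
      by (auto split: if_splits)
    moreover have "?C \<subseteq> V" using narrow_subset Cons.prems(4) by (rule subset_trans)
    ultimately show ?thesis
      using Cons.IH[OF hist(2-4)] source_in_narrow'[OF Cons.prems(4,5)] by blast
  qed
qed

lemma probing_wins:
  assumes "floor_log (card V) \<le> count_list us s"
  shows "wins (probing V E us) X s"
  using probing_wins_aux[of us 0 V us] assms source_in_V by (simp add: candidates_def)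

lemma tolerated_infections_probing_aux:
  assumes "length (history (probing V E us) X i) = i"
    and "candidates V E (history (probing V E us) X i) = C"
    and "drop i us = us'" "C \<subseteq> V" "s \<in> C"
  shows "(\<Sum>j. case probing V E us (history (probing V E us) X (j + i)) of
             Watch W \<Rightarrow> of_nat (card (dom (X (j + i)))) | Name v \<Rightarrow> 0)
    = (of_nat (probing_cost V E X i C us') :: ennreal)"
  using assms
proof (induction us' arbitrary: i C)
  case Nil
  then have "probing V E us (history (probing V E us) X i) = Name (SOME v. v \<in> C)"
    using probing_exhausted[of us "history (probing V E us) X i" V E] by simp
  from history_constant[of "probing V E us", OF this] this show ?case
    by (simp add: add.commute[of _ i])
next
  case (Cons u us')
  let ?\<sigma> = "probing V E us"
  let ?f = "\<lambda>j. (case ?\<sigma> (history ?\<sigma> X j) of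
             Watch W \<Rightarrow> of_nat (card (dom (X j))) | Name v \<Rightarrow> 0) :: ennreal"
  show ?case
  proof (cases "2 \<le> card C")
    case False
    then have "?\<sigma> (history ?\<sigma> X i) = Name s"
      using Cons.prems by (blast intro: name_source)
    from history_constant[of "probing V E us", OF this] this False show ?thesis
      by (simp add: add.commute[of _ i])
  next
    case True
    let ?C = "narrow V E C (X i |` probe V E C u)"
    note hist = history_probing_Suc[OF Cons.prems(1-3) True]
    have "?C \<subseteq> V" using narrow_subset Cons.prems(4) by (rule subset_trans)
    then have IH: "(\<Sum>j. ?f (j + Suc i)) = of_nat (probing_cost V E X (Suc i) ?C us')"
      using Cons.IH[OF hist(2-4)] source_in_narrow'[OF Cons.prems(4,5)] by blast
    have "(\<Sum>j. ?f (j + i)) = (\<Sum>j. ?f (j + Suc i)) + ?f i"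
      by (rule suminf_ennreal_split_head)
    also have "\<dots> = of_nat (probing_cost V E X i C (u # us'))"
      unfolding IH hist(1) using True by (simp add: add.commute)
    finally show ?thesis .
  qed
qed

lemma tolerated_infections_probing:
  "tolerated_infections (probing V E us) X = of_nat (probing_cost V E X 0 V us)"
  using tolerated_infections_probing_aux[of us 0 V us] source_in_V
  by (simp add: candidates_def tolerated_infections_def cong: action.case_cong)

lemma probing_cost_le: "probing_cost V E X i C us \<le> card V * length us"
proof (induction us arbitrary: i C)
  case (Cons u us)
  have "card (dom (X i)) \<le> card V"
    using finite_V dom_chain_subset by (rule card_mono)
  with Cons show ?case by (auto intro: add_mono)
qed simp

lemma probing_cost_inactive: "\<not> 2 \<le> card C \<Longrightarrow> probing_cost V E X i C us = 0"
  by (cases us) auto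

text \<open>A random round that infects \<open>k\<close> nodes costs \<open>k\<close>, but hits an infected node, and hence
  lowers the logarithmic potential, with probability \<open>k / card V\<close>; the weight \<open>2 * card V\<close> of the
  potential pays for the round twice. The second payment, at least \<open>1\<close>, is saved up as the
  summand \<open>j\<close>, to be used for the bounded cost of the tail \<open>D\<close>.\<close>

lemma sum_probing_cost_le:
  fixes D :: "'v list"
  defines "B \<equiv> card V * length D"
  assumes "C \<subseteq> V" "s \<in> C" "j \<le> B"
  shows "(\<Sum>us\<in>{us. set us \<subseteq> V \<and> length us = j}. probing_cost V E X i C (us @ D))
      + j * card V ^ j \<le> card V ^ j * (2 * card V * floor_log (card C) + B)"
  using assms(2-)
proof (induction j arbitrary: i C)
  case 0
  have "{us. set us \<subseteq> V \<and> length us = 0} = {[]}" by auto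
  then show ?case using probing_cost_le[of i C D] by (simp add: B_def)
next
  case (Suc j)
  let ?n = "card V" and ?k = "card (dom (X i))"
  let ?L = "{us. set us \<subseteq> V \<and> length us = j}"
  let ?C = "\<lambda>u. narrow V E C (X i |` probe V E C u)"
  let ?\<phi> = "\<lambda>C. floor_log (card C)"
  show ?case
  proof (cases "2 \<le> card C")
    case False
    have "Suc j * ?n ^ Suc j \<le> B * ?n ^ Suc j"
      using Suc.prems(3) by (rule mult_le_mono1)
    also have "\<dots> \<le> ?n ^ Suc j * (2 * ?n * ?\<phi> C + B)"
      by (subst mult.commute) (intro mult_le_mono2 le_add2)
    finally show ?thesis
      by (simp only: probing_cost_inactive[OF False] sum.neutral_const add_0)
  next
    case True
    have cardL: "card ?L = ?n ^ j" using finite_V by (rule card_lists_length_eq)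
    have "finite (dom (X i))" using finite_V dom_chain_subset finite_subset by blast
    then have k: "1 \<le> ?k" using source_infected[of i] by (metis One_nat_def Suc_leI card_gt_0_iff empty_iff)
    have IH: "(\<Sum>us\<in>?L. probing_cost V E X (Suc i) (?C u) (us @ D)) + j * ?n ^ j
        \<le> ?n ^ j * (2 * ?n * ?\<phi> (?C u) + B)" for u
      using Suc.prems narrow_subset[of V E C] source_in_narrow'[OF Suc.prems(1,2)]
      by (intro Suc.IH) (auto intro: subset_trans)
    have "(\<Sum>u\<in>V. ?\<phi> (?C u)) + ?k = (\<Sum>u\<in>V. ?\<phi> (?C u) + (if u \<in> dom (X i) then 1 else 0))"
      using finite_V dom_chain_subset[of i]
      by (simp add: sum.distrib sum.If_cases Int_absorb1)
    also have "\<dots> \<le> (\<Sum>u\<in>V. ?\<phi> C)"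
      using floor_log_narrow_infected[OF Suc.prems(1,2) _ True, of _ i]
        floor_log_narrow_le[OF Suc.prems(1)]
      by (intro sum_mono) (simp del: Int_insert_right_if1)
    finally have \<phi>: "(\<Sum>u\<in>V. ?\<phi> (?C u)) + ?k \<le> ?n * ?\<phi> C" by simp
    have "(\<Sum>us\<in>{us. set us \<subseteq> V \<and> length us = Suc j}. probing_cost V E X i C (us @ D))
        + Suc j * ?n ^ Suc j
      = (\<Sum>u\<in>V. \<Sum>us\<in>?L. ?k + probing_cost V E X (Suc i) (?C u) (us @ D)) + Suc j * ?n ^ Suc j"
      using True by (simp add: sum_lists_Suc[OF finite_V])
    also have "\<dots> = ?n * ?n ^ j * (?k + 1)
        + (\<Sum>u\<in>V. (\<Sum>us\<in>?L. probing_cost V E X (Suc i) (?C u) (us @ D)) + j * ?n ^ j)"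
      by (simp add: sum.distrib cardL algebra_simps)
    also have "\<dots> \<le> ?n * ?n ^ j * (?k + 1) + (\<Sum>u\<in>V. ?n ^ j * (2 * ?n * ?\<phi> (?C u) + B))"
      using IH by (intro add_left_mono sum_mono)
    also have "\<dots> = ?n ^ Suc j * (2 * (\<Sum>u\<in>V. ?\<phi> (?C u)) + ?k + 1 + B)"
      by (simp add: sum.distrib sum_distrib_left algebra_simps)
    also have "\<dots> \<le> ?n ^ Suc j * (2 * ?n * ?\<phi> C + B)"
      using \<phi> k by (intro mult_left_mono) auto
    finally show ?thesis .
  qed
qed

end

definition sweeps :: "'v set \<Rightarrow> 'v list" where
  "sweeps V = concat (replicate (floor_log (card V)) (SOME vs. set vs = V))"

lemma count_list_sweeps:
  assumes "finite V" "s \<in> V"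
  shows "floor_log (card V) \<le> count_list (sweeps V) s"
proof -
  define vs where "vs = (SOME vs. set vs = V)"
  have "set vs = V"
    unfolding vs_def using finite_list[OF assms(1)] by (rule someI_ex)
  then have "1 \<le> count_list vs s" using assms(2) count_list_0_iff[of vs s] by (simp add: Suc_le_eq)
  then have "k \<le> count_list (concat (replicate k vs)) s" for k
    by (induction k) auto
  then show ?thesis by (simp add: sweeps_def vs_def)
qed

definition random_probing :: "'v discoverer" where
  "random_probing V E Tmax \<delta> =
     map_pmf (\<lambda>us. probing V E (us @ sweeps V))
       (pmf_of_set {us. set us \<subseteq> V \<and> length us = card V * length (sweeps V)})"

lemma expected_infections_random_probing:
  assumes tree: "tree_graph V E"
    and chain: "\<And>i. \<exists>t\<^sub>0. infection_chain V E l \<delta> s t\<^sub>0 (X i)"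
  shows "expected_infections (random_probing V E Tmax \<delta>) X
    \<le> ennreal (2 * real (card V) * log 2 (real (card V)))"
proof -
  let ?N = "card V * length (sweeps V)"
  let ?L = "{us. set us \<subseteq> V \<and> length us = ?N}"
  let ?c = "\<lambda>us. probing_cost V E X 0 V (us @ sweeps V)"
  have fin: "finite V" using finite_V[OF tree chain] .
  have s: "s \<in> V" using source_in_V[OF tree chain] .
  have n: "0 < card V" using fin s card_gt_0_iff by blast
  have cardL: "card ?L = card V ^ ?N" using fin by (rule card_lists_length_eq)
  have finL: "finite ?L" using fin by (rule finite_lists_length_eq)
  have neL: "?L \<noteq> {}" using cardL n by (metis card.empty less_numeral_extra(3) zero_less_power)
  have "(\<Sum>us\<in>?L. ?c us) + ?N * card V ^ ?N
      \<le> card V ^ ?N * (2 * card V * floor_log (card V) + ?N)"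
    using sum_probing_cost_le[OF tree chain order.refl s order.refl] .
  then have "(\<Sum>us\<in>?L. ?c us) \<le> card V ^ ?N * (2 * card V * floor_log (card V))"
    by (simp add: algebra_simps)
  then have "real (\<Sum>us\<in>?L. ?c us) \<le> real (card V ^ ?N) * real (2 * card V * floor_log (card V))"
    unfolding of_nat_mult[symmetric] of_nat_le_iff .
  then have "real (\<Sum>us\<in>?L. ?c us) / real (card ?L) \<le> real (2 * card V * floor_log (card V))"
    using n by (simp add: cardL field_simps)
  also have "\<dots> \<le> 2 * real (card V) * log 2 (real (card V))"
    using n by (simp add: floor_log_altdef)
  finally have le: "real (\<Sum>us\<in>?L. ?c us) / real (card ?L)
    \<le> 2 * real (card V) * log 2 (real (card V))" .
  have "expected_infections (random_probing V E Tmax \<delta>) X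
    = (\<Sum>us\<in>?L. of_nat (?c us)) / of_nat (card ?L)"
    unfolding expected_infections_def random_probing_def
    by (simp add: nn_integral_pmf_of_set[OF neL finL] tolerated_infections_probing[OF tree chain])
  also have "\<dots> = ennreal (real (\<Sum>us\<in>?L. ?c us) / real (card ?L))"
    using n by (simp add: cardL divide_ennreal[symmetric] ennreal_of_nat_eq_real_of_nat[symmetric]
        sum_nonneg flip: of_nat_sum of_nat_power)
  also have "\<dots> \<le> ennreal (2 * real (card V) * log 2 (real (card V)))"
    using le by (rule ennreal_leI)
  finally show ?thesis .
qed

lemma random_probing_wins:
  assumes tree: "tree_graph V E"
    and chain: "\<And>i. \<exists>t\<^sub>0. infection_chain V E l \<delta> s t\<^sub>0 (X i)"
    and \<sigma>: "\<sigma> \<in> set_pmf (random_probing V E Tmax \<delta>)"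
  shows "watches_at_most 2 V \<sigma>" "wins \<sigma> X s"
proof -
  obtain us where \<sigma>: "\<sigma> = probing V E (us @ sweeps V)"
    using \<sigma> by (auto simp: random_probing_def)
  show "watches_at_most 2 V \<sigma>" unfolding \<sigma> by (rule watches_at_most_probing)
  show "wins \<sigma> X s"
    unfolding \<sigma> using count_list_sweeps[OF finite_V[OF tree chain] source_in_V[OF tree chain]]
    by (intro probing_wins[OF tree chain]) simp
qed

theorem theorem8:
  shows "\<exists>(A :: 'v discoverer) (f :: nat \<Rightarrow> real).
    f \<in> O(\<lambda>n. real n * ln (real n)) \<and>
    (\<forall>V E Tmax \<delta> l s X.
       sd_instance V E Tmax \<delta> l s X \<and> tree_graph V E \<longrightarrow>
         (\<forall>\<sigma>\<in>set_pmf (A V E Tmax \<delta>). watches_at_most 2 V \<sigma> \<and> wins \<sigma> X s) \<and>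
         expected_infections (A V E Tmax \<delta>) X \<le> ennreal (f (card V)))"
proof (intro exI conjI allI impI)
  show "(\<lambda>n. 2 * real n * log 2 (real n)) \<in> O(\<lambda>n. real n * ln (real n))"
    by (intro bigoI[of _ "2 / ln 2"]) (auto simp: log_def abs_mult)
next
  fix V :: "'v set" and E Tmax \<delta> l s X
  assume "sd_instance V E Tmax \<delta> l s X \<and> tree_graph V E"
  then have *: "tree_graph V E" "\<And>i. \<exists>t\<^sub>0. infection_chain V E l \<delta> s t\<^sub>0 (X i)"
    by (auto simp: sd_instance_def)
  show "\<forall>\<sigma>\<in>set_pmf (random_probing V E Tmax \<delta>). watches_at_most 2 V \<sigma> \<and> wins \<sigma> X s"
    using random_probing_wins[where X = X, OF *] by blast
  show "expected_infections (random_probing V E Tmax \<delta>) X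
      \<le> ennreal (2 * real (card V) * log 2 (real (card V)))"
    by (rule expected_infections_random_probing[OF *])
qed

end
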